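(* There is a signed multiple discrete set $A$ (in $\mathbb{R}^p$ for some $p\ge1$) such that its associated measure $\mu_A$ is almost periodic in the sense of distributions and is not almost periodic in the weak sense.
   Context: A continuous function $f$ on $\mathbb{R}^p$ is almost periodic if for every $\varepsilon>0$ the set $\{\tau\in\mathbb{R}^p:\sup_{x\in\mathbb{R}^p}|f(x+\tau)-f(x)|<\varepsilon\}$ is relatively dense in $\mathbb{R}^p$, i.e. there is $R=R(\varepsilon)<\infty$ such that every ball of radius $R$ contains an element of this set. A signed multiple discrete set $A=\{(x,m(x))\}$ in $\mathbb{R}^p$ is a discrete (locally finite) set $s(A)\subset\mathbb{R}^p$ together with a number $m(x)\in\mathbb{Z}\setminus\{0\}$ for each $x\in s(A)$. Its associated measure is the (locally finite) signed measure $\mu_A=\sum_{x\in s(A)}m(x)\delta_x$, where $\delta_x$ is the unit mass at $x$. A locally finite signed Borel measure $\mu$ on $\mathbb{R}^p$ is almost periodic in the weak sense if for every continuous compactly supported function $\varphi$ on $\mathbb{R}^p$ the function $x\mapsto\int\varphi(x+t)\,d\mu(t)$ is almost periodic on $\mathbb{R}^p$. It is almost periodic in the sense of distributions if the same holds for every compactly supported $\varphi\in C^\infty(\mathbb{R}^p)$. *)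

theory Defs
  imports "HOL-Analysis.Analysis"
begin

text \<open>
  The dimension \<open>p\<close> is a natural number that is quantified over, so \<open>\<real>\<^sup>p\<close> is the space
  \<^term>\<open>Euclidean_space p\<close>: its points are the sequences \<open>x :: nat \<Rightarrow> real\<close> with \<open>x i = 0\<close>
  for all \<open>i \<ge> p\<close>. Functions on \<open>\<real>\<^sup>p\<close> are total on \<open>nat \<Rightarrow> real\<close>; their values outside
  \<open>\<real>\<^sup>p\<close> play no role below.
\<close>

type_synonym vec = "nat \<Rightarrow> real"

abbreviation Rp :: "nat \<Rightarrow> vec set" where
  "Rp p \<equiv> topspace (Euclidean_space p)"

definition vplus :: "vec \<Rightarrow> vec \<Rightarrow> vec" where
  "vplus x y = (\<lambda>i. x i + y i)"

definition edist :: "nat \<Rightarrow> vec \<Rightarrow> vec \<Rightarrow> real" where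
  "edist p x y = L2_set (\<lambda>i. x i - y i) {..<p}"

definition borel_Rp :: "nat \<Rightarrow> vec measure" where
  "borel_Rp p = sigma (Rp p) {U. openin (Euclidean_space p) U}"


subsection \<open>Almost periodic functions\<close>

definition eps_almost_periods :: "nat \<Rightarrow> (vec \<Rightarrow> real) \<Rightarrow> real \<Rightarrow> vec set" where
  "eps_almost_periods p f \<epsilon> =
     {\<tau> \<in> Rp p. (SUP x\<in>Rp p. ereal \<bar>f (vplus x \<tau>) - f x\<bar>) < ereal \<epsilon>}"

definition relatively_dense :: "nat \<Rightarrow> vec set \<Rightarrow> bool" where
  "relatively_dense p E \<longleftrightarrow> (\<exists>R::real. \<forall>c\<in>Rp p. \<exists>\<tau>\<in>E. edist p c \<tau> < R)"

definition almost_periodic :: "nat \<Rightarrow> (vec \<Rightarrow> real) \<Rightarrow> bool" where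
  "almost_periodic p f \<longleftrightarrow>
     continuous_map (Euclidean_space p) euclideanreal f \<and>
     (\<forall>\<epsilon>>0. relatively_dense p (eps_almost_periods p f \<epsilon>))"


subsection \<open>Test functions\<close>

definition compactly_supported :: "nat \<Rightarrow> (vec \<Rightarrow> real) \<Rightarrow> bool" where
  "compactly_supported p \<phi> \<longleftrightarrow>
     compactin (Euclidean_space p) (Euclidean_space p closure_of {x \<in> Rp p. \<phi> x \<noteq> 0})"

definition partial_deriv :: "nat \<Rightarrow> (vec \<Rightarrow> real) \<Rightarrow> vec \<Rightarrow> real" where
  "partial_deriv i f x = deriv (\<lambda>t. f (x(i := t))) (x i)"

primrec iterated_partial :: "nat list \<Rightarrow> (vec \<Rightarrow> real) \<Rightarrow> vec \<Rightarrow> real" where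
  "iterated_partial [] f = f"
| "iterated_partial (i # is) f = partial_deriv i (iterated_partial is f)"

text \<open>\<open>C\<^sup>\<infinity>(\<real>\<^sup>p)\<close>: all iterated partial derivatives, of all orders, exist and are continuous.\<close>

definition smooth :: "nat \<Rightarrow> (vec \<Rightarrow> real) \<Rightarrow> bool" where
  "smooth p f \<longleftrightarrow>
     (\<forall>is \<in> lists {..<p}.
        continuous_map (Euclidean_space p) euclideanreal (iterated_partial is f) \<and>
        (\<forall>i<p. \<forall>x\<in>Rp p.
           (\<lambda>t. iterated_partial is f (x(i := t))) differentiable (at (x i))))"


subsection \<open>Locally finite signed measures\<close>

text \<open>
  A locally finite signed measure need not be defined on unbounded Borel sets
  (\<open>\<infinity> - \<infinity>\<close>), so it is given as a pair \<open>(P, N)\<close> of locally finite positive Borel measures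
  and stands for \<open>P - N\<close>. The integral of a continuous compactly supported function depends
  only on this difference.
\<close>

type_synonym signed_measure = "vec measure \<times> vec measure"

definition locally_finite_measure :: "nat \<Rightarrow> vec measure \<Rightarrow> bool" where
  "locally_finite_measure p M \<longleftrightarrow>
     sets M = sets (borel_Rp p) \<and>
     (\<forall>x\<in>Rp p. \<exists>U. openin (Euclidean_space p) U \<and> x \<in> U \<and> emeasure M U < \<infinity>)"

definition locally_finite_signed_measure :: "nat \<Rightarrow> signed_measure \<Rightarrow> bool" where
  "locally_finite_signed_measure p \<mu> \<longleftrightarrow>
     locally_finite_measure p (fst \<mu>) \<and> locally_finite_measure p (snd \<mu>)"

definition signed_integral :: "signed_measure \<Rightarrow> (vec \<Rightarrow> real) \<Rightarrow> real" where
  "signed_integral \<mu> f = (\<integral>t. f t \<partial>fst \<mu>) - (\<integral>t. f t \<partial>snd \<mu>)"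

definition almost_periodic_weak :: "nat \<Rightarrow> signed_measure \<Rightarrow> bool" where
  "almost_periodic_weak p \<mu> \<longleftrightarrow>
     locally_finite_signed_measure p \<mu> \<and>
     (\<forall>\<phi>. continuous_map (Euclidean_space p) euclideanreal \<phi> \<and> compactly_supported p \<phi> \<longrightarrow>
        almost_periodic p (\<lambda>x. signed_integral \<mu> (\<lambda>t. \<phi> (vplus x t))))"

definition almost_periodic_distributions :: "nat \<Rightarrow> signed_measure \<Rightarrow> bool" where
  "almost_periodic_distributions p \<mu> \<longleftrightarrow>
     locally_finite_signed_measure p \<mu> \<and>
     (\<forall>\<phi>. smooth p \<phi> \<and> compactly_supported p \<phi> \<longrightarrow>
        almost_periodic p (\<lambda>x. signed_integral \<mu> (\<lambda>t. \<phi> (vplus x t))))"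


subsection \<open>Signed multiple discrete sets\<close>

text \<open>Only the values of the multiplicity \<open>m\<close> on the support \<open>S\<close> are relevant.\<close>

definition signed_multiple_discrete_set :: "nat \<Rightarrow> vec set \<Rightarrow> (vec \<Rightarrow> int) \<Rightarrow> bool" where
  "signed_multiple_discrete_set p S m \<longleftrightarrow>
     S \<subseteq> Rp p \<and>
     (\<forall>x\<in>Rp p. \<exists>U. openin (Euclidean_space p) U \<and> x \<in> U \<and> finite (S \<inter> U)) \<and>
     (\<forall>x\<in>S. m x \<noteq> 0)"

text \<open>
  \<open>weighted_deltas p S w\<close> is the Borel measure \<open>\<Sum>x\<in>S. w(x) \<delta>\<^sub>x\<close>, where negative weights
  count as \<open>0\<close>. The weights \<open>m\<close> and \<open>-m\<close> thus give the positive and negative part of the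
  associated measure.
\<close>

definition weighted_deltas :: "nat \<Rightarrow> vec set \<Rightarrow> (vec \<Rightarrow> real) \<Rightarrow> vec measure" where
  "weighted_deltas p S w = distr (point_measure S (\<lambda>x. ennreal (w x))) (borel_Rp p) (\<lambda>x. x)"

definition associated_measure :: "nat \<Rightarrow> vec set \<Rightarrow> (vec \<Rightarrow> int) \<Rightarrow> signed_measure" where
  "associated_measure p S m =
     (weighted_deltas p S (\<lambda>x. of_int (m x)), weighted_deltas p S (\<lambda>x. - of_int (m x)))"

end

theory Submission
  imports Defs
begin

text \<open>
  In dimension one, place at every integer \<open>k \<noteq> 0\<close> a dipole of mass \<open>\<plusminus>3\<^sup>v\<close> and width \<open>4\<^sup>-\<^sup>v\<^sup>-\<^sup>1\<close>,
  where \<open>v\<close> is the 2-adic valuation of \<open>k\<close>. Against a Lipschitz test function a dipole has size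
  \<open>O((3/4)\<^sup>v)\<close>, so a translation by a multiple of \<open>2\<^sup>n\<close>, which affects only dipoles with \<open>v \<ge> n\<close>, changes
  the convolution by \<open>O((3/4)\<^sup>n)\<close>. Against a test function with a square root cusp the dipole has
  size of order \<open>(3/2)\<^sup>v\<close>; the convolution is then unbounded, whereas almost periodic functions are
  bounded.
\<close>

declare One_nat_def [simp del]

section \<open>Discrete sets and their associated measures\<close>

lemma space_borel_Rp [simp]: "space (borel_Rp p) = Rp p"
  unfolding borel_Rp_def by (rule space_measure_of) (auto dest: openin_subset)

lemma sets_borel_Rp: "sets (borel_Rp p) = sigma_sets (Rp p) {U. openin (Euclidean_space p) U}"
  unfolding borel_Rp_def by (rule sets_measure_of) (auto dest: openin_subset)

lemma openin_sets_borel_Rp: "openin (Euclidean_space p) U \<Longrightarrow> U \<in> sets (borel_Rp p)"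
  by (simp add: sets_borel_Rp sigma_sets.Basic)

lemma continuous_map_borel_measurable:
  assumes "continuous_map (Euclidean_space p) euclideanreal f"
  shows "f \<in> borel_measurable (borel_Rp p)"
proof (rule borel_measurableI)
  fix U :: "real set"
  assume "open U"
  then have "openin (Euclidean_space p) {x \<in> Rp p. f x \<in> U}"
    using assms openin_continuous_map_preimage by fastforce
  moreover have "f -` U \<inter> space (borel_Rp p) = {x \<in> Rp p. f x \<in> U}"
    by auto
  ultimately show "f -` U \<inter> space (borel_Rp p) \<in> sets (borel_Rp p)"
    by (simp add: openin_sets_borel_Rp)
qed

lemma locally_finite_weighted_deltas:
  assumes "signed_multiple_discrete_set p S m"
  shows "locally_finite_measure p (weighted_deltas p S w)"
  unfolding locally_finite_measure_def
proof (intro conjI ballI)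
  show "sets (weighted_deltas p S w) = sets (borel_Rp p)"
    by (simp add: weighted_deltas_def)
next
  fix x assume "x \<in> Rp p"
  then obtain U where U: "openin (Euclidean_space p) U" "x \<in> U" "finite (S \<inter> U)"
    using assms unfolding signed_multiple_discrete_set_def by blast
  have S: "S \<subseteq> Rp p"
    using assms by (simp add: signed_multiple_discrete_set_def)
  have "emeasure (weighted_deltas p S w) U = emeasure (point_measure S (\<lambda>x. ennreal (w x))) (S \<inter> U)"
    unfolding weighted_deltas_def using S U
    by (subst emeasure_distr)
      (auto simp: openin_sets_borel_Rp space_point_measure Int_commute intro!: arg_cong2[where f=emeasure])
  also have "\<dots> = (\<Sum>x\<in>S \<inter> U. ennreal (w x))"
    using U by (intro emeasure_point_measure_finite2) auto
  also have "\<dots> < \<infinity>"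
    using U by (auto simp: less_top)
  finally show "\<exists>U. openin (Euclidean_space p) U \<and> x \<in> U \<and> emeasure (weighted_deltas p S w) U < \<infinity>"
    using U by blast
qed

lemma locally_finite_associated_measure:
  assumes "signed_multiple_discrete_set p S m"
  shows "locally_finite_signed_measure p (associated_measure p S m)"
  using locally_finite_weighted_deltas[OF assms]
  by (simp add: locally_finite_signed_measure_def associated_measure_def)

text \<open>Since \<open>f\<close> vanishes on \<open>S\<close> off \<open>F\<close>, the integral
  of a density over counting measure collapses to a finite sum. The factor
  \<open>max 0 (w x)\<close> appears because \<open>ennreal\<close> truncates negative weights to
  0.\<close>

lemma integral_weighted_deltas:
  assumes S: "S \<subseteq> Rp p" and f: "f \<in> borel_measurable (borel_Rp p)"
    and F: "finite F" "F \<subseteq> S" "\<And>x. x \<in> S - F \<Longrightarrow> f x = 0"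
  shows "(\<integral>x. f x \<partial>weighted_deltas p S w) = (\<Sum>x\<in>F. max 0 (w x) * f x)"
proof -
  let ?g = "\<lambda>x. max 0 (w x)"
  have "(\<integral>x. f x \<partial>weighted_deltas p S w) = (\<integral>x. f x \<partial>point_measure S (\<lambda>x. ennreal (w x)))"
    unfolding weighted_deltas_def using S f by (intro integral_distr) auto
  also have "point_measure S (\<lambda>x. ennreal (w x)) = density (count_space S) (\<lambda>x. ennreal (?g x))"
    unfolding point_measure_def by (intro arg_cong2[where f=density]) (auto simp: max_def ennreal_neg)
  also have "(\<integral>x. f x \<partial>density (count_space S) (\<lambda>x. ennreal (?g x))) =
      (\<integral>x. ?g x *\<^sub>R f x \<partial>count_space S)"
    by (intro integral_density) auto
  also have "\<dots> = (\<Sum>x | x \<in> S \<and> ?g x *\<^sub>R f x \<noteq> 0. ?g x *\<^sub>R f x)"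
    by (intro lebesgue_integral_count_space_finite_support rev_finite_subset[OF F(1)]) (use F in auto)
  also have "\<dots> = (\<Sum>x\<in>F. ?g x * f x)"
    using F by (intro sum.mono_neutral_cong_left) auto
  finally show ?thesis .
qed

text \<open>The positive and negative parts recombine by
  \<open>max 0 a - max 0 (- a) = a\<close>.\<close>

lemma signed_integral_associated_measure:
  assumes "S \<subseteq> Rp p" "f \<in> borel_measurable (borel_Rp p)"
    and "finite F" "F \<subseteq> S" "\<And>x. x \<in> S - F \<Longrightarrow> f x = 0"
  shows "signed_integral (associated_measure p S m) f = (\<Sum>x\<in>F. of_int (m x) * f x)"
proof -
  have "signed_integral (associated_measure p S m) f =
      (\<Sum>x\<in>F. max 0 (of_int (m x)) * f x) - (\<Sum>x\<in>F. max 0 (- of_int (m x)) * f x)"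
    unfolding signed_integral_def associated_measure_def fst_conv snd_conv
    using integral_weighted_deltas[OF assms, of "\<lambda>x. of_int (m x)"]
      integral_weighted_deltas[OF assms, of "\<lambda>x. - of_int (m x)"] by simp
  also have "\<dots> = (\<Sum>x\<in>F. of_int (m x) * f x)"
    unfolding sum_subtractf[symmetric] by (intro sum.cong refl) (auto simp: max_def)
  finally show ?thesis .
qed

section \<open>The real line as a one-dimensional Euclidean space\<close>

text \<open>Identifies the real line with \<open>Rp 1\<close>, so that continuity, compact support
  and almost periodicity there become statements about functions of a real variable.\<close>

definition vec1 :: "real \<Rightarrow> vec" where
  "vec1 t = (\<lambda>i. if i = 0 then t else 0)"

lemma vec1_0 [simp]: "vec1 t 0 = t"
  by (simp add: vec1_def)

lemma vec1_in_Rp [simp]: "vec1 t \<in> Rp 1"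
  by (simp add: vec1_def topspace_Euclidean_space)

lemma vec1_surj: "x \<in> Rp 1 \<Longrightarrow> x = vec1 (x 0)"
  by (auto simp: vec1_def topspace_Euclidean_space fun_eq_iff)

lemma vec1_eq_iff [simp]: "vec1 s = vec1 t \<longleftrightarrow> s = t"
  by (metis vec1_0)

lemma vplus_vec1 [simp]: "vplus (vec1 s) (vec1 t) = vec1 (s + t)"
  by (auto simp: vec1_def vplus_def)

lemma edist_vec1 [simp]: "edist 1 (vec1 s) (vec1 t) = \<bar>s - t\<bar>"
  by (simp add: edist_def One_nat_def lessThan_Suc)

lemma vec1_upd [simp]: "(vec1 s)(0 := t) = vec1 t"
  by (auto simp: vec1_def)

lemma Rp_1_eq: "Rp 1 = range vec1"
  using vec1_surj by auto

lemma continuous_map_vec1: "continuous_map euclideanreal (Euclidean_space 1) vec1"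
  using continuous_map_componentwise_Euclidean_space[of euclideanreal 1 "\<lambda>x i. x"]
  by (simp add: vec1_def[abs_def])

lemma continuous_map_coordinate: "continuous_map (Euclidean_space p) euclideanreal (\<lambda>x. x i)"
  unfolding Euclidean_space_def
  by (intro continuous_map_from_subtopology continuous_map_product_projection) simp

text \<open>\<open>vec1\<close> and the coordinate \<open>x 0\<close> are mutually inverse
  continuous maps between the line and \<open>Rp 1\<close>; composing with one or the other
  transfers continuity.\<close>

lemma continuous_map_Rp_1_iff:
  "continuous_map (Euclidean_space 1) euclideanreal f \<longleftrightarrow> continuous_on UNIV (\<lambda>t. f (vec1 t))"
proof
  assume "continuous_map (Euclidean_space 1) euclideanreal f"
  then have "continuous_map euclideanreal euclideanreal (f \<circ> vec1)"
    by (rule continuous_map_compose[OF continuous_map_vec1])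
  then show "continuous_on UNIV (\<lambda>t. f (vec1 t))"
    by (simp add: o_def)
next
  assume "continuous_on UNIV (\<lambda>t. f (vec1 t))"
  then have "continuous_map euclideanreal euclideanreal (\<lambda>t. f (vec1 t))"
    by simp
  from continuous_map_compose[OF continuous_map_coordinate this]
  have "continuous_map (Euclidean_space 1) euclideanreal (\<lambda>x. f (vec1 (x 0)))"
    by (simp add: o_def)
  then show "continuous_map (Euclidean_space 1) euclideanreal f"
    by (rule continuous_map_eq) (metis vec1_surj)
qed

section \<open>Test functions on the line\<close>

text \<open>In one direction the coordinate is bounded on the compact support; in the other the
  support is enclosed in the image of \<open>{-L..L}\<close>, which is compact and hence closed in a
  Hausdorff space.\<close>

lemma compactly_supported_1_iff:
  "compactly_supported 1 \<phi> \<longleftrightarrow> (\<exists>L. \<forall>t. \<bar>t\<bar> > L \<longrightarrow> \<phi> (vec1 t) = 0)"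
proof
  let ?A = "{x \<in> Rp 1. \<phi> x \<noteq> 0}"
  {
    assume "compactly_supported 1 \<phi>"
    then have "compactin euclideanreal ((\<lambda>x. x 0) ` (Euclidean_space 1 closure_of ?A))"
      unfolding compactly_supported_def by (rule image_compactin) (rule continuous_map_coordinate)
    then obtain L where L: "\<And>x. x \<in> Euclidean_space 1 closure_of ?A \<Longrightarrow> \<bar>x 0\<bar> \<le> L"
      by (metis (no_types, lifting) bounded_iff compact_imp_bounded compactin_euclidean_iff image_eqI real_norm_def)
    have "?A \<subseteq> Euclidean_space 1 closure_of ?A"
      by (rule closure_of_subset) auto
    have "\<phi> (vec1 t) = 0" if "\<bar>t\<bar> > L" for t
    proof (rule ccontr)
      assume "\<phi> (vec1 t) \<noteq> 0"
      then have "vec1 t \<in> ?A"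
        by simp
      then have "vec1 t \<in> Euclidean_space 1 closure_of ?A"
        using \<open>?A \<subseteq> _\<close> by (rule rev_subsetD)
      from L[OF this] that show False
        by simp
    qed
    then show "\<exists>L. \<forall>t. \<bar>t\<bar> > L \<longrightarrow> \<phi> (vec1 t) = 0"
      by blast
  }
  {
    assume "\<exists>L. \<forall>t. \<bar>t\<bar> > L \<longrightarrow> \<phi> (vec1 t) = 0"
    then obtain L where L: "\<And>t. \<bar>t\<bar> > L \<Longrightarrow> \<phi> (vec1 t) = 0"
      by blast
    have compact: "compactin (Euclidean_space 1) (vec1 ` {-L..L})"
      by (rule image_compactin[OF _ continuous_map_vec1]) simp
    have "?A \<subseteq> vec1 ` {-L..L}"
    proof
      fix x assume x: "x \<in> ?A"
      then have "x = vec1 (x 0)"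
        by (intro vec1_surj) simp
      with x L[of "x 0"] have "\<not> \<bar>x 0\<bar> > L"
        by auto
      then have "x 0 \<in> {-L..L}"
        by auto
      with \<open>x = vec1 (x 0)\<close> show "x \<in> vec1 ` {-L..L}"
        by (rule image_eqI)
    qed
    moreover have "closedin (Euclidean_space 1) (vec1 ` {-L..L})"
      by (intro compactin_imp_closedin Hausdorff_Euclidean_space compact)
    ultimately have "Euclidean_space 1 closure_of ?A \<subseteq> vec1 ` {-L..L}"
      by (rule closure_of_minimal)
    then show "compactly_supported 1 \<phi>"
      unfolding compactly_supported_def
      by (intro closed_compactin[OF compact]) auto
  }
qed

text \<open>The derivative is continuous, hence bounded on \<open>{-L..L}\<close>, and it vanishes
  outside; the mean value inequality then gives a global Lipschitz constant.\<close>

lemma smooth_compactly_supported_lipschitz: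
  assumes smooth: "smooth 1 \<phi>" and L: "\<And>t. \<bar>t\<bar> > L \<Longrightarrow> \<phi> (vec1 t) = 0"
  obtains M where "M > 0" "\<And>s t. \<bar>\<phi> (vec1 s) - \<phi> (vec1 t)\<bar> \<le> M * \<bar>s - t\<bar>"
proof -
  define g where "g t = \<phi> (vec1 t)" for t
  have diff: "g differentiable (at t)" for t
  proof -
    have "(\<lambda>t'. iterated_partial [] \<phi> ((vec1 t)(0 := t'))) differentiable (at (vec1 t 0))"
      using smooth vec1_in_Rp[of t] unfolding smooth_def
      by (metis less_one lists.Nil)
    then show ?thesis
      by (simp add: g_def[abs_def])
  qed
  then have der: "(g has_real_derivative deriv g t) (at t)" for t
    by (simp add: DERIV_deriv_iff_real_differentiable)
  have "continuous_map (Euclidean_space 1) euclideanreal (iterated_partial [0] \<phi>)"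
    using smooth unfolding smooth_def by (auto dest!: bspec[of _ _ "[0]"])
  then have cont: "continuous_on UNIV (deriv g)"
    unfolding continuous_map_Rp_1_iff by (simp add: partial_deriv_def g_def[abs_def])
  have "bounded (deriv g ` {-L..L})"
    by (intro compact_imp_bounded compact_continuous_image continuous_on_subset[OF cont]) auto
  then obtain M where M: "M > 0" "\<And>t. t \<in> {-L..L} \<Longrightarrow> \<bar>deriv g t\<bar> \<le> M"
    unfolding bounded_pos by auto
  have bound: "\<bar>deriv g t\<bar> \<le> M" for t
  proof (cases "t \<in> {-L..L}")
    case False
    \<comment> \<open>Off the interval \<open>g\<close> vanishes on a whole neighbourhood of
      \<open>t\<close>, which forces its derivative at \<open>t\<close> to be 0.\<close>
    then have "t \<in> {s. \<bar>s\<bar> > L}"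
      by auto
    moreover have "open {s::real. \<bar>s\<bar> > L}"
      by (intro open_Collect_less continuous_intros)
    ultimately have "eventually (\<lambda>s. s \<in> {s. \<bar>s\<bar> > L}) (nhds t)"
      by (intro eventually_nhds_in_open)
    then have "eventually (\<lambda>s. g s = 0) (nhds t)"
      by eventually_elim (simp add: g_def L)
    then have "deriv g t = deriv (\<lambda>_. 0) t"
      by (rule deriv_cong_ev) simp
    then show ?thesis
      using M by simp
  qed (use M in auto)
  have "\<bar>g s - g t\<bar> \<le> M * \<bar>s - t\<bar>" for s t
    using field_differentiable_bound[of UNIV g "deriv g" M t s] der bound
    by (simp add: abs_minus_commute)
  with M(1) show ?thesis
    using that by (simp add: g_def)
qed

section \<open>Almost periodic functions on the line\<close>

lemma eps_almost_periods_bound: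
  assumes "\<tau> \<in> eps_almost_periods p f \<epsilon>" "x \<in> Rp p"
  shows "\<bar>f (vplus x \<tau>) - f x\<bar> < \<epsilon>"
proof -
  have "ereal \<bar>f (vplus x \<tau>) - f x\<bar> \<le> (SUP x\<in>Rp p. ereal \<bar>f (vplus x \<tau>) - f x\<bar>)"
    using assms(2) by (rule SUP_upper)
  also have "\<dots> < ereal \<epsilon>"
    using assms(1) by (simp add: eps_almost_periods_def)
  finally show ?thesis
    by simp
qed

text \<open>A 1-almost period carries any point into \<open>{-R..R}\<close>, where continuity gives
  a bound, and changes the value by less than 1.\<close>

lemma almost_periodic_1_bounded:
  assumes "almost_periodic 1 f"
  obtains B where "\<And>t. \<bar>f (vec1 t)\<bar> \<le> B"
proof -
  have "relatively_dense 1 (eps_almost_periods 1 f 1)"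
    using assms unfolding almost_periodic_def by simp
  then obtain R where R: "\<And>c. c \<in> Rp 1 \<Longrightarrow> \<exists>\<tau>\<in>eps_almost_periods 1 f 1. edist 1 c \<tau> < R"
    unfolding relatively_dense_def by blast
  have "continuous_on UNIV (\<lambda>t. f (vec1 t))"
    using assms unfolding almost_periodic_def continuous_map_Rp_1_iff by blast
  then have "bounded ((\<lambda>t. f (vec1 t)) ` {-R..R})"
    by (intro compact_imp_bounded compact_continuous_image) (auto intro: continuous_on_subset)
  then obtain B where B: "\<And>t. t \<in> {-R..R} \<Longrightarrow> \<bar>f (vec1 t)\<bar> \<le> B"
    unfolding bounded_iff real_norm_def by blast
  have "\<bar>f (vec1 t)\<bar> \<le> B + 1" for t
  proof -
    \<comment> \<open>Centring the ball at \<open>- t\<close> makes the almost period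
      \<open>vec1 u\<close> found in it satisfy \<open>\<bar>t + u\<bar> < R\<close>.\<close>
    obtain \<tau> where \<tau>: "\<tau> \<in> eps_almost_periods 1 f 1" "edist 1 (vec1 (-t)) \<tau> < R"
      using R[of "vec1 (-t)"] by auto
    then have "\<tau> \<in> Rp 1"
      by (simp add: eps_almost_periods_def)
    then obtain u where u: "\<tau> = vec1 u"
      using vec1_surj by blast
    have "\<bar>f (vec1 (t + u)) - f (vec1 t)\<bar> < 1"
      using eps_almost_periods_bound[OF \<tau>(1) vec1_in_Rp, of t] by (simp add: u)
    moreover have "\<bar>f (vec1 (t + u))\<bar> \<le> B"
      using \<tau>(2) by (intro B) (auto simp: u)
    ultimately show ?thesis
      by linarith
  qed
  then show ?thesis
    using that by blast
qed

text \<open>The integer multiples of \<open>T\<close> already form a relatively dense set of almost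
  periods, since \<open>t\<close> lies within \<open>T\<close> of
  \<open>\<lfloor>t / T\<rfloor> * T\<close>.\<close>

lemma almost_periodic_1I:
  assumes cont: "continuous_on UNIV (\<lambda>t. f (vec1 t))"
    and per: "\<And>\<epsilon>. \<epsilon> > 0 \<Longrightarrow>
      \<exists>T>0. \<forall>j::int. \<forall>t. \<bar>f (vec1 (t + of_int j * T)) - f (vec1 t)\<bar> \<le> \<epsilon>"
  shows "almost_periodic 1 f"
  unfolding almost_periodic_def
proof (intro conjI allI impI)
  show "continuous_map (Euclidean_space 1) euclideanreal f"
    using cont by (simp only: continuous_map_Rp_1_iff)
next
  fix \<epsilon> :: real assume "\<epsilon> > 0"
  \<comment> \<open>A pointwise bound passes to the supremum only as \<le>; halving \<epsilon>
    recovers the strict inequality.\<close>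
  then obtain T where T: "T > 0"
    "\<And>(j::int) t. \<bar>f (vec1 (t + of_int j * T)) - f (vec1 t)\<bar> \<le> \<epsilon> / 2"
    using per[of "\<epsilon> / 2"] by auto
  have "vec1 (of_int j * T) \<in> eps_almost_periods 1 f \<epsilon>" for j :: int
  proof -
    have "(SUP x\<in>Rp 1. ereal \<bar>f (vplus x (vec1 (of_int j * T))) - f x\<bar>) \<le> ereal (\<epsilon> / 2)"
      unfolding Rp_1_eq by (intro SUP_least) (use T in auto)
    also have "\<dots> < ereal \<epsilon>"
      using \<open>\<epsilon> > 0\<close> by simp
    finally show ?thesis
      unfolding eps_almost_periods_def by simp
  qed
  moreover have "edist 1 (vec1 t) (vec1 (of_int \<lfloor>t / T\<rfloor> * T)) < T" for t
  proof -
    have "of_int \<lfloor>t / T\<rfloor> * T \<le> t" "t < (of_int \<lfloor>t / T\<rfloor> + 1) * T"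
      using T(1) floor_divide_lower[of T t] floor_divide_upper[of T t] by simp_all
    then show ?thesis
      by (simp add: algebra_simps)
  qed
  ultimately show "relatively_dense 1 (eps_almost_periods 1 f \<epsilon>)"
    unfolding relatively_dense_def Rp_1_eq by blast
qed

section \<open>A sequence of dipoles\<close>

text \<open>The \<open>Suc\<close> in the exponent keeps the width at most 1/4 even for odd
  \<open>k\<close>, so dipoles at different integers stay apart. As
  \<open>multiplicity 2 0 = 0\<close>, the value at 0 is 1/4 and the bounds hold for every
  \<open>k\<close>.\<close>

definition gap :: "int \<Rightarrow> real" where
  "gap k = (1/4) ^ Suc (multiplicity 2 k)"

definition dipole_set :: "vec set" where
  "dipole_set = vec1 ` (\<Union>k\<in>-{0}. {of_int k, of_int k + gap k})"

text \<open>The multiplicity has to be read off from the point alone: as the gap lies strictly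
  between 0 and 1, the floor recovers the index of the dipole, and integrality tells its positive
  end from its negative one.\<close>

definition dipole_mult :: "vec \<Rightarrow> int" where
  "dipole_mult x = (if x 0 \<in> \<int> then 1 else -1) * 3 ^ multiplicity 2 \<lfloor>x 0\<rfloor>"

text \<open>The contribution of one dipole to the convolution, with \<open>t\<close> the translated
  position of its positive end. The value at \<open>k = 0\<close> is 0 because no dipole sits
  there.\<close>

definition dipole :: "(real \<Rightarrow> real) \<Rightarrow> int \<Rightarrow> real \<Rightarrow> real" where
  "dipole g k t = (if k = 0 then 0 else 3 ^ multiplicity 2 k * (g t - g (t + gap k)))"

lemma gap_bounds: "0 < gap k" "gap k \<le> 1/4"
  by (auto simp: gap_def power_le_one)

lemma floor_add_gap: "\<lfloor>of_int k + gap k\<rfloor> = k"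
  using gap_bounds[of k] by (intro floor_unique) auto

lemma add_gap_notin_Ints: "of_int k + gap k \<notin> \<int>"
proof
  assume "of_int k + gap k \<in> \<int>"
  then have "of_int \<lfloor>of_int k + gap k\<rfloor> = of_int k + gap k"
    by (rule of_int_floor)
  then show False
    using gap_bounds[of k] by (simp add: floor_add_gap)
qed

lemma dipole_mult_vec1 [simp]:
  "dipole_mult (vec1 (of_int k)) = 3 ^ multiplicity 2 k"
  "dipole_mult (vec1 (of_int k + gap k)) = - (3 ^ multiplicity 2 k)"
  by (simp_all add: dipole_mult_def add_gap_notin_Ints floor_add_gap)

lemma finite_int_window: "finite {k::int. \<bar>t + of_int k\<bar> \<le> c}"
  and card_int_window: "c \<ge> 0 \<Longrightarrow> real (card {k::int. \<bar>t + of_int k\<bar> \<le> c}) \<le> 2 * c + 1"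
proof -
  have eq: "{k::int. \<bar>t + of_int k\<bar> \<le> c} = {\<lceil>-t - c\<rceil>..\<lfloor>-t + c\<rfloor>}"
    by (auto simp: ceiling_le_iff le_floor_iff abs_le_iff)
  show "finite {k::int. \<bar>t + of_int k\<bar> \<le> c}"
    by (simp add: eq)
  assume "c \<ge> 0"
  then show "real (card {k::int. \<bar>t + of_int k\<bar> \<le> c}) \<le> 2 * c + 1"
    unfolding eq card_atLeastAtMost_int by linarith
qed

lemma dipole_set_discrete: "signed_multiple_discrete_set 1 dipole_set dipole_mult"
  unfolding signed_multiple_discrete_set_def
proof (intro conjI ballI)
  show "dipole_set \<subseteq> Rp 1"
    by (auto simp: dipole_set_def)
next
  fix x assume "x \<in> dipole_set"
  then show "dipole_mult x \<noteq> 0"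
    by (auto simp: dipole_mult_def)
next
  fix x assume x: "x \<in> Rp 1"
  define U where "U = {y \<in> Rp 1. y 0 \<in> ball (x 0) 1}"
  have "openin (Euclidean_space 1) U"
    unfolding U_def by (rule openin_continuous_map_preimage[OF continuous_map_coordinate]) auto
  \<comment> \<open>The radius 1 of \<open>U\<close> plus a gap of at most 1/4 keeps the index
    \<open>k\<close> within 2 of \<open>x 0\<close>.\<close>
  moreover have "dipole_set \<inter> U \<subseteq>
      vec1 ` (\<Union>k\<in>{k. \<bar>- x 0 + of_int k\<bar> \<le> 2}. {of_int k, of_int k + gap k})" (is "_ \<subseteq> ?B")
  proof
    fix y assume y: "y \<in> dipole_set \<inter> U"
    then obtain k where k: "y = vec1 (of_int k) \<or> y = vec1 (of_int k + gap k)"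
      by (auto simp: dipole_set_def)
    then have "\<bar>- x 0 + of_int k\<bar> \<le> 2"
      using y gap_bounds[of k] by (auto simp: U_def dist_real_def)
    with k show "y \<in> ?B"
      by blast
  qed
  moreover have "finite ?B"
    by (intro finite_imageI finite_UN_I finite_int_window) auto
  ultimately show "\<exists>U. openin (Euclidean_space 1) U \<and> x \<in> U \<and> finite (dipole_set \<inter> U)"
    using x by (intro exI[of _ U]) (auto simp: U_def intro: finite_subset)
qed

text \<open>Grouping the two ends of each dipole turns the integral into a sum over indices.
  \<open>K\<close> may be any finite set covering the dipoles that the translate of \<phi> meets, so
  one \<open>K\<close> can serve several values of \<open>y\<close>.\<close>

lemma signed_integral_dipole_set:
  assumes cont: "continuous_map (Euclidean_space 1) euclideanreal \<phi>" and K: "finite K"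
    and zero: "\<And>k. k \<notin> K \<Longrightarrow> \<phi> (vec1 (y + of_int k)) = 0"
              "\<And>k. k \<notin> K \<Longrightarrow> \<phi> (vec1 (y + of_int k + gap k)) = 0"
  shows "signed_integral (associated_measure 1 dipole_set dipole_mult) (\<lambda>t. \<phi> (vplus (vec1 y) t)) =
    (\<Sum>k\<in>K. dipole (\<lambda>t. \<phi> (vec1 t)) k (y + of_int k))"
proof -
  define A where "A = (\<lambda>k::int. vec1 (of_int k)) ` (K - {0})"
  define B where "B = (\<lambda>k::int. vec1 (of_int k + gap k)) ` (K - {0})"
  let ?f = "\<lambda>t. \<phi> (vplus (vec1 y) t)"
  let ?m = "\<lambda>x. real_of_int (dipole_mult x)"
  have "continuous_on UNIV (\<lambda>t. ?f (vec1 t))"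
    using cont unfolding continuous_map_Rp_1_iff vplus_vec1
    by (rule continuous_on_compose2) (auto intro!: continuous_intros)
  then have meas: "?f \<in> borel_measurable (borel_Rp 1)"
    by (intro continuous_map_borel_measurable) (simp only: continuous_map_Rp_1_iff)
  have inj: "inj_on (\<lambda>k::int. vec1 (of_int k + gap k)) (K - {0})"
    by (rule inj_onI) (metis vec1_eq_iff floor_add_gap)
  have disj: "A \<inter> B = {}"
    unfolding A_def B_def by safe (metis Ints_of_int add_gap_notin_Ints vec1_eq_iff)
  have "signed_integral (associated_measure 1 dipole_set dipole_mult) ?f = (\<Sum>x\<in>A \<union> B. ?m x * ?f x)"
  proof (rule signed_integral_associated_measure[OF _ meas])
    show "finite (A \<union> B)" "A \<union> B \<subseteq> dipole_set"
      using K by (auto simp: A_def B_def dipole_set_def)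
    show "dipole_set \<subseteq> Rp 1"
      by (auto simp: dipole_set_def)
    fix x assume x: "x \<in> dipole_set - (A \<union> B)"
    then obtain k where k: "k \<noteq> 0" "x = vec1 (of_int k) \<or> x = vec1 (of_int k + gap k)"
      by (auto simp: dipole_set_def)
    with x have "k \<notin> K"
      by (auto simp: A_def B_def)
    with zero[of k] k(2) show "?f x = 0"
      by (auto simp: add.assoc)
  qed
  also have "\<dots> = (\<Sum>x\<in>A. ?m x * ?f x) + (\<Sum>x\<in>B. ?m x * ?f x)"
    using K disj by (intro sum.union_disjoint) (auto simp: A_def B_def)
  also have "(\<Sum>x\<in>A. ?m x * ?f x) =
      (\<Sum>k\<in>K - {0}. 3 ^ multiplicity 2 k * \<phi> (vec1 (y + of_int k)))"
    unfolding A_def by (subst sum.reindex) (auto simp: inj_on_def)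
  also have "(\<Sum>x\<in>B. ?m x * ?f x) =
      (\<Sum>k\<in>K - {0}. - (3 ^ multiplicity 2 k * \<phi> (vec1 (y + of_int k + gap k))))"
    unfolding B_def by (subst sum.reindex[OF inj]) (auto simp: add.assoc)
  also have "(\<Sum>k\<in>K - {0}. 3 ^ multiplicity 2 k * \<phi> (vec1 (y + of_int k))) + \<dots> =
      (\<Sum>k\<in>K. dipole (\<lambda>t. \<phi> (vec1 t)) k (y + of_int k))"
    \<comment> \<open>Index 0 may be put back, since \<open>dipole\<close> is 0 there.\<close>
    unfolding sum.distrib[symmetric] using K
    by (intro sum.mono_neutral_cong_left) (auto simp: dipole_def algebra_simps)
  finally show ?thesis .
qed

section \<open>Shifting the index by multiples of \<open>2 ^ n\<close>\<close>

text \<open>The valuation of \<open>k\<close> is below \<open>n\<close> and that of a nonzero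
  \<open>l\<close> is at least \<open>n\<close>; a sum of terms with distinct valuations has the
  smaller one. The case \<open>l = 0\<close> is separate because its \<open>multiplicity\<close> is
  0 by convention.\<close>

lemma multiplicity_2_add:
  fixes k l :: int
  assumes "\<not> 2 ^ n dvd k" "2 ^ n dvd l"
  shows "multiplicity 2 (k + l) = multiplicity 2 k"
proof (cases "l = 0")
  case False
  have "k \<noteq> 0"
    using assms by auto
  have "multiplicity 2 k < n"
    using assms(1) multiplicity_dvd' not_less by blast
  also have "n \<le> multiplicity 2 l"
    using assms(2) False by (intro multiplicity_geI) auto
  finally show ?thesis
    using \<open>k \<noteq> 0\<close> False by (intro multiplicity_sum_lt)
qed simp

lemma dipole_add_period:
  assumes "\<not> 2 ^ n dvd k" "2 ^ n dvd l"
  shows "dipole g (k + l) t = dipole g k t"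
proof -
  have "k \<noteq> 0" "k + l \<noteq> 0"
    using assms by (auto simp: dvd_add_left_iff) (metis add.commute assms(2) dvd_0_right dvd_add_right_iff)
  then show ?thesis
    by (simp add: dipole_def gap_def multiplicity_2_add[OF assms])
qed

text \<open>Mass times Lipschitz bound is \<open>3 ^ v * M * (1/4) ^ Suc v\<close>, that is
  \<open>M / 4 * (3/4) ^ v\<close>, and divisibility by \<open>2 ^ n\<close> gives
  \<open>v \<ge> n\<close>.\<close>

lemma dipole_small:
  assumes lip: "\<And>s t. \<bar>g s - g t\<bar> \<le> M * \<bar>s - t\<bar>" and "2 ^ n dvd k" and "M > 0"
  shows "\<bar>dipole g k t\<bar> \<le> M * (3/4) ^ n"
proof (cases "k = 0")
  case True
  then show ?thesis
    using \<open>M > 0\<close> by (simp add: dipole_def)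
next
  case False
  let ?v = "multiplicity 2 k"
  have "n \<le> ?v"
    using assms(2) False by (intro multiplicity_geI) auto
  have "\<bar>dipole g k t\<bar> = 3 ^ ?v * \<bar>g t - g (t + gap k)\<bar>"
    using False by (simp add: dipole_def abs_mult)
  also have "\<dots> \<le> 3 ^ ?v * (M * gap k)"
    using lip[of t "t + gap k"] gap_bounds(1)[of k] by (intro mult_left_mono) auto
  also have "\<dots> = M / 4 * (3/4) ^ ?v"
    by (simp add: gap_def power_divide)
  also have "\<dots> \<le> M * (3/4) ^ n"
    using \<open>n \<le> ?v\<close> \<open>M > 0\<close> by (intro mult_mono power_decreasing) auto
  finally show ?thesis .
qed

text \<open>Adding \<open>l\<close> preserves divisibility by \<open>2 ^ n\<close>: either both
  dipoles are small, or they have the same mass and width and the difference is 0.\<close>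

lemma dipole_diff_small:
  assumes lip: "\<And>s t. \<bar>g s - g t\<bar> \<le> M * \<bar>s - t\<bar>" and l: "2 ^ n dvd l" and M: "M > 0"
  shows "\<bar>dipole g (k + l) t - dipole g k t\<bar> \<le> 2 * M * (3/4) ^ n"
proof (cases "2 ^ n dvd k")
  case True
  then show ?thesis
    using dipole_small[OF lip True M, of t] dipole_small[OF lip dvd_add[OF True l] M, of t] by linarith
next
  case False
  then show ?thesis
    using dipole_add_period[OF False l] M by simp
qed

lemma continuous_on_dipole: "continuous_on UNIV g \<Longrightarrow> continuous_on UNIV (\<lambda>t. dipole g k (t + c))"
  unfolding dipole_def
  by (cases "k = 0") (auto intro!: continuous_intros elim: continuous_on_compose2)

section \<open>Smooth test functions against a cusp\<close>

lemma dipole_distributions: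
  "almost_periodic_distributions 1 (associated_measure 1 dipole_set dipole_mult)"
  unfolding almost_periodic_distributions_def
proof (intro conjI allI impI locally_finite_associated_measure[OF dipole_set_discrete])
  fix \<phi> assume \<phi>: "smooth 1 \<phi> \<and> compactly_supported 1 \<phi>"
  let ?g = "\<lambda>t. \<phi> (vec1 t)"
  let ?f = "\<lambda>x. signed_integral (associated_measure 1 dipole_set dipole_mult) (\<lambda>t. \<phi> (vplus x t))"
  have cont: "continuous_map (Euclidean_space 1) euclideanreal \<phi>"
    using \<phi> unfolding smooth_def by (auto dest!: bspec[of _ _ "[]"])
  then have contg: "continuous_on UNIV ?g"
    by (simp only: continuous_map_Rp_1_iff)
  obtain L0 where L0: "\<And>t. \<bar>t\<bar> > L0 \<Longrightarrow> ?g t = 0"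
    using \<phi> unfolding compactly_supported_1_iff by blast
  define L where "L = max 0 L0"
  have L: "\<And>t. \<bar>t\<bar> > L \<Longrightarrow> ?g t = 0" and "L \<ge> 0"
    using L0 by (auto simp: L_def)
  obtain M where M: "M > 0" and lip: "\<And>s t. \<bar>?g s - ?g t\<bar> \<le> M * \<bar>s - t\<bar>"
    using smooth_compactly_supported_lipschitz[OF conjunct1[OF \<phi>] L] by blast
  \<comment> \<open>The margin 1 exceeds the gap, so a dipole with index outside the window has both
    ends beyond \<open>L\<close>.\<close>
  have f_eq: "?f (vec1 y) = (\<Sum>k\<in>K. dipole ?g k (y + of_int k))"
    if "finite K" "{k. \<bar>y + of_int k\<bar> \<le> L + 1} \<subseteq> K" for K y
  proof (rule signed_integral_dipole_set[OF cont that(1)])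
    fix k assume "k \<notin> K"
    then have *: "\<bar>y + of_int k\<bar> > L + 1"
      using that(2) by force
    show "\<phi> (vec1 (y + of_int k)) = 0"
      using * by (intro L) linarith
    show "\<phi> (vec1 (y + of_int k + gap k)) = 0"
      using * gap_bounds[of k] by (intro L) linarith
  qed
  show "almost_periodic 1 ?f"
  proof (rule almost_periodic_1I)
    show "continuous_on UNIV (\<lambda>t. ?f (vec1 t))"
      unfolding continuous_on_eq_continuous_at[OF open_UNIV]
    proof
      fix c :: real
      \<comment> \<open>For \<open>y\<close> within 1 of \<open>c\<close> the window of radius
        \<open>L + 1\<close> at \<open>y\<close> lies in this one, so a single finite sum represents
        the convolution near \<open>c\<close>.\<close>
      define K where "K = {k::int. \<bar>c + of_int k\<bar> \<le> L + 2}"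
      have K: "finite K"
        unfolding K_def by (rule finite_int_window)
      have "eventually (\<lambda>y. y \<in> ball c 1) (nhds c)"
        by (intro eventually_nhds_in_open) auto
      then have "eventually (\<lambda>y. ?f (vec1 y) = (\<Sum>k\<in>K. dipole ?g k (y + of_int k))) (nhds c)"
        by eventually_elim (intro f_eq[OF K], auto simp: K_def dist_real_def)
      moreover have "isCont (\<lambda>y. \<Sum>k\<in>K. dipole ?g k (y + of_int k)) c"
        using continuous_on_dipole[OF contg]
        by (intro continuous_intros) (simp add: continuous_on_eq_continuous_at)
      ultimately show "isCont (\<lambda>t. ?f (vec1 t)) c"
        by (simp only: isCont_cong)
    qed
  next
    fix \<epsilon> :: real assume "\<epsilon> > 0"
    \<comment> \<open>At most \<open>2 * (L + 1) + 1\<close> dipoles lie in the window, and each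
      changes by at most \<open>2 * M * (3/4) ^ n\<close>.\<close>
    define C where "C = (2 * (L + 1) + 1) * (2 * M)"
    have "C > 0"
      using \<open>L \<ge> 0\<close> M by (simp add: C_def)
    then obtain n where n: "(3/4::real) ^ n < \<epsilon> / C"
      using \<open>\<epsilon> > 0\<close> real_arch_pow_inv[of "\<epsilon> / C" "3/4"] by auto
    show "\<exists>T>0. \<forall>j::int. \<forall>t. \<bar>?f (vec1 (t + of_int j * T)) - ?f (vec1 t)\<bar> \<le> \<epsilon>"
    proof (intro exI conjI allI)
      show "(2::real) ^ n > 0"
        by simp
      fix j :: int and t :: real
      define l where "l = j * 2 ^ n"
      define K where "K = {k::int. \<bar>(t + of_int l) + of_int k\<bar> \<le> L + 1}"
      have finK: "finite K"
        unfolding K_def by (rule finite_int_window)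
      have "?f (vec1 (t + of_int l)) = (\<Sum>k\<in>K. dipole ?g k (t + of_int (k + l)))"
        by (subst f_eq[OF finK]) (auto simp: K_def algebra_simps)
      \<comment> \<open>The window at \<open>t\<close> is the window at \<open>t + l\<close> shifted
        by \<open>l\<close>. After reindexing, both sums run over \<open>K\<close> with the same
        arguments, and only the dipole index differs, by \<open>l\<close>.\<close>
      moreover have "?f (vec1 t) = (\<Sum>k\<in>(\<lambda>k. k + l) ` K. dipole ?g k (t + of_int k))"
      proof (rule f_eq)
        show "{k. \<bar>t + of_int k\<bar> \<le> L + 1} \<subseteq> (\<lambda>k. k + l) ` K"
        proof
          fix k :: int assume "k \<in> {k. \<bar>t + of_int k\<bar> \<le> L + 1}"
          then show "k \<in> (\<lambda>k. k + l) ` K"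
            by (intro image_eqI[of _ _ "k - l"]) (auto simp: K_def)
        qed
      qed (use finK in auto)
      then have "?f (vec1 t) = (\<Sum>k\<in>K. dipole ?g (k + l) (t + of_int (k + l)))"
        by (simp add: sum.reindex inj_on_def)
      ultimately have "\<bar>?f (vec1 (t + of_int l)) - ?f (vec1 t)\<bar> =
          \<bar>\<Sum>k\<in>K. dipole ?g (k + l) (t + of_int (k + l)) - dipole ?g k (t + of_int (k + l))\<bar>"
        by (simp add: sum_subtractf)
      also have "\<dots> \<le> (\<Sum>k\<in>K. 2 * M * (3/4) ^ n)"
        by (intro order_trans[OF sum_abs] sum_mono dipole_diff_small lip M) (simp add: l_def)
      also have "\<dots> = real (card K) * (2 * M) * (3/4) ^ n"
        by simp
      also have "\<dots> \<le> C * (3/4) ^ n"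
        unfolding C_def K_def using M \<open>L \<ge> 0\<close>
        by (intro mult_right_mono card_int_window) auto
      also have "\<dots> \<le> \<epsilon>"
        using n \<open>C > 0\<close> by (simp add: field_simps)
      finally show "\<bar>?f (vec1 (t + of_int j * 2 ^ n)) - ?f (vec1 t)\<bar> \<le> \<epsilon>"
        by (simp add: l_def)
    qed
  qed
qed

lemma dipole_not_weak:
  "\<not> almost_periodic_weak 1 (associated_measure 1 dipole_set dipole_mult)"
proof
  assume weak: "almost_periodic_weak 1 (associated_measure 1 dipole_set dipole_mult)"
  \<comment> \<open>The cusp at 0 gives a drop of \<open>sqrt h\<close> over a small distance
    \<open>h\<close>, so a gap of \<open>(1/4) ^ Suc n\<close> yields \<open>(1/2) ^ Suc n\<close>.
    The height 1/2 confines the support to \<open>\<bar>t\<bar> \<le> 1/4\<close>.\<close>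
  define \<phi> :: "vec \<Rightarrow> real" where "\<phi> x = max 0 (1/2 - sqrt \<bar>x 0\<bar>)" for x
  let ?f = "\<lambda>x. signed_integral (associated_measure 1 dipole_set dipole_mult) (\<lambda>t. \<phi> (vplus x t))"
  have zero: "\<phi> (vec1 t) = 0" if "\<bar>t\<bar> \<ge> 1/4" for t
  proof -
    have "sqrt ((1/2)\<^sup>2) \<le> sqrt \<bar>t\<bar>"
      using that by (intro real_sqrt_le_mono) (simp add: power2_eq_square)
    then show ?thesis
      by (simp add: \<phi>_def)
  qed
  have cont: "continuous_map (Euclidean_space 1) euclideanreal \<phi>"
    unfolding continuous_map_Rp_1_iff \<phi>_def by (auto intro!: continuous_intros)
  moreover have "compactly_supported 1 \<phi>"
    unfolding compactly_supported_1_iff using zero by (intro exI[of _ "1/4"]) auto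
  ultimately have "almost_periodic 1 ?f"
    using weak unfolding almost_periodic_weak_def by blast
  then obtain B where B: "\<And>t. \<bar>?f (vec1 t)\<bar> \<le> B"
    using almost_periodic_1_bounded by blast
  have "(3/2) ^ n / 2 \<le> B" for n
  proof -
    define k :: int where "k = 2 ^ n"
    have mult: "multiplicity 2 k = n"
      unfolding k_def by (rule multiplicity_prime_power) simp
    have "sqrt (gap k) = (1/2) ^ Suc n"
      unfolding gap_def mult real_sqrt_power by (simp add: real_sqrt_divide)
    \<comment> \<open>This keeps the \<open>max\<close> in \<phi> inactive at the negative end of
      the dipole.\<close>
    moreover have "(1/2::real) ^ n \<le> 1"
      by (simp add: power_le_one)
    ultimately have gap: "\<phi> (vec1 (gap k)) = 1/2 - (1/2) ^ Suc n"
      using gap_bounds(1)[of k] by (simp add: \<phi>_def)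
    have far: "\<bar>- real_of_int k + of_int i\<bar> \<ge> 1" if "i \<noteq> k" for i
      using that by linarith
    \<comment> \<open>Translating by \<open>- k\<close> puts the positive end of dipole
      \<open>k\<close> at the cusp. Both ends of every other dipole land at distance at least 3/4
      from 0, where \<phi> vanishes.\<close>
    have "?f (vec1 (- of_int k)) =
        (\<Sum>i\<in>{k}. dipole (\<lambda>t. \<phi> (vec1 t)) i (- of_int k + of_int i))"
    proof (rule signed_integral_dipole_set[OF cont])
      fix i assume "i \<notin> {k}"
      then have far: "\<bar>- real_of_int k + of_int i\<bar> \<ge> 1"
        using far by simp
      show "\<phi> (vec1 (- of_int k + of_int i)) = 0"
        using far by (intro zero) linarith
      show "\<phi> (vec1 (- of_int k + of_int i + gap i)) = 0"
        using far gap_bounds[of i] by (intro zero) linarith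
    qed simp
    also have "\<dots> = 3 ^ n * (1/2) ^ Suc n"
      using gap by (simp add: dipole_def mult) (simp add: k_def \<phi>_def)
    also have "\<dots> = (3/2) ^ n / 2"
      by (simp add: power_divide)
    finally show ?thesis
      using B[of "- of_int k"] by linarith
  qed
  then have "(3/2) ^ n \<le> 2 * B" for n
    by (simp add: field_simps)
  moreover obtain n where "(3/2::real) ^ n > 2 * B"
    using real_arch_pow[of "3/2" "2 * B"] by auto
  ultimately show False
    by (meson not_less)
qed

theorem theorem5:
  shows "\<exists>p\<ge>1. \<exists>(S :: vec set) (m :: vec \<Rightarrow> int).
    signed_multiple_discrete_set p S m \<and>
    almost_periodic_distributions p (associated_measure p S m) \<and>
    \<not> almost_periodic_weak p (associated_measure p S m)"
proof (intro exI conjI)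
  show "signed_multiple_discrete_set 1 dipole_set dipole_mult"
    by (rule dipole_set_discrete)
  show "almost_periodic_distributions 1 (associated_measure 1 dipole_set dipole_mult)"
    by (rule dipole_distributions)
  show "\<not> almost_periodic_weak 1 (associated_measure 1 dipole_set dipole_mult)"
    by (rule dipole_not_weak)
qed simp

end
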